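(* Let $f:\mathbb{R}^n\to\mathbb{R}\cup\{+\infty\}$ and $g:\mathbb{R}^m\to\mathbb{R}\cup\{+\infty\}$ be proper closed convex functions, let $A\in\mathbb{R}^{m\times n}$, suppose that a primal-dual solution pair of $\min_x f(x)+g(Ax)$ and its dual exists, and let $M_1\in\mathbb{R}^{n\times n}$ and $M_2\in\mathbb{R}^{m\times m}$ be symmetric positive definite. Suppose that in the iPrePDHG algorithm the iterator $S$ is chosen as the proximal-gradient step for the $z$-subproblem with stepsize $\gamma\in\left(0,\frac{2\lambda_{\min}(M_2)}{\lambda_{\max}^2(M_2)}\right)$, and that it is repeated $p$ times in every outer iteration, where $p\ge 1$. Then, for every outer iteration $k\ge 0$, $z^{k+1}=z^{k+1}_p$ is an approximate solution to the $z$-subproblem up to a bounded relative error with constant $$c=c(p)=\frac{\frac{1}{\gamma}+\lambda_{\max}(M_2)}{1-\tau^p}\,(\tau^p+\tau^{p-1}),\qquad \tau=\sqrt{1-\gamma\big(2\lambda_{\min}(M_2)-\gamma\lambda_{\max}^2(M_2)\big)}<1.$$ That is, there exists $\varepsilon^{k+1}\in\mathbb{R}^m$ with $$\mathbf{0}\in\partial g^*(z^{k+1})+M_2\big(z^{k+1}-z^k-M_2^{-1}A(2x^{k+1}-x^k)\big)+\varepsilon^{k+1},\qquad \|\varepsilon^{k+1}\|\le c(p)\,\|z^{k+1}-z^k\|.$$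
   Context: $\|\cdot\|$ is the Euclidean norm, $\|v\|_M^2=\langle v,Mv\rangle$, and $\lambda_{\min},\lambda_{\max}$ are the smallest and largest eigenvalues. $f^*,g^*$ are convex conjugates. The dual problem is $\min_{z} f^*(-A^Tz)+g^*(z)$. A primal-dual solution pair is $(x^\star,z^\star)$ with $\mathbf{0}\in\partial f(x^\star)+A^Tz^\star$ and $\mathbf{0}\in\partial g(Ax^\star)-z^\star$. For $M\succ0$, $\mathrm{Prox}^M_\phi(x)=\arg\min_y\{\phi(y)+\frac12\|y-x\|_M^2\}$, and $\mathrm{Prox}_{\gamma\phi}(x)=\arg\min_y\{\phi(y)+\frac{1}{2\gamma}\|y-x\|^2\}$. The iPrePDHG algorithm, started at $(x^0,z^0)$, performs for $k=0,1,\dots$: $x^{k+1}=\mathrm{Prox}^{M_1}_f(x^k-M_1^{-1}A^Tz^k)$; $z^{k+1}_0=z^k$; $z^{k+1}_{i+1}=S(z^{k+1}_i,x^{k+1},x^k)$ for $i=0,\dots,p-1$; $z^{k+1}=z^{k+1}_p$. The inner loop approximately solves the $z$-subproblem, which is to compute $\mathrm{Prox}^{M_2}_{g^*}(z^k+M_2^{-1}A(2x^{k+1}-x^k))$, i.e. to minimize $h_1(z)+h_2(z)$ with $h_1=g^*$ and $h_2(z)=\frac12\|z-z^k-M_2^{-1}A(2x^{k+1}-x^k)\|_{M_2}^2$. The proximal-gradient step with stepsize $\gamma$ is $z^{k+1}_{i+1}=\mathrm{Prox}_{\gamma h_1}\big(z^{k+1}_i-\gamma\nabla h_2(z^{k+1}_i)\big)$.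 Convention: $\tau^0=1$. *)

theory Defs
  imports "HOL-Analysis.Analysis"
begin

text \<open>Functions into \<open>\<real> \<union> {+\<infinity>}\<close> are modelled as \<^typ>\<open>ereal\<close>-valued functions; the value
  \<open>-\<infinity>\<close> is excluded by properness. Closedness and convexity are those of the epigraph.
  (The library's \<open>epigraph\<close> is for real-valued functions only.)\<close>

definition ext_epigraph :: "('a \<Rightarrow> ereal) \<Rightarrow> ('a \<times> real) set"
  where "ext_epigraph \<phi> = {(x, r). \<phi> x \<le> ereal r}"

definition proper_fun :: "('a \<Rightarrow> ereal) \<Rightarrow> bool"
  where "proper_fun \<phi> \<longleftrightarrow> (\<forall>x. \<phi> x \<noteq> -\<infinity>) \<and> (\<exists>x. \<phi> x \<noteq> \<infinity>)"

definition closed_fun :: "('a::topological_space \<Rightarrow> ereal) \<Rightarrow> bool"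
  where "closed_fun \<phi> \<longleftrightarrow> closed (ext_epigraph \<phi>)"

definition convex_fun :: "('a::real_vector \<Rightarrow> ereal) \<Rightarrow> bool"
  where "convex_fun \<phi> \<longleftrightarrow> convex (ext_epigraph \<phi>)"

definition conjugate :: "('a::real_inner \<Rightarrow> ereal) \<Rightarrow> 'a \<Rightarrow> ereal"
  where "conjugate \<phi> z = (SUP x. ereal (z \<bullet> x) - \<phi> x)"

text \<open>For proper \<open>\<phi>\<close> the subdifferential is empty wherever \<open>\<phi>\<close> takes the value \<open>+\<infinity>\<close>.\<close>

definition subdifferential :: "('a::real_inner \<Rightarrow> ereal) \<Rightarrow> 'a \<Rightarrow> 'a set"
  where "subdifferential \<phi> x = {u. \<forall>y. \<phi> x + ereal (u \<bullet> (y - x)) \<le> \<phi> y}"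

definition primal_dual_solution ::
    "(real^'n \<Rightarrow> ereal) \<Rightarrow> (real^'m \<Rightarrow> ereal) \<Rightarrow> real^'n^'m \<Rightarrow> real^'n \<Rightarrow> real^'m \<Rightarrow> bool"
  where "primal_dual_solution f g A x z \<longleftrightarrow>
    0 \<in> (\<lambda>u. u + transpose A *v z) ` subdifferential f x \<and>
    0 \<in> (\<lambda>v. v - z) ` subdifferential g (A *v x)"

definition sym_pos_def :: "real^'n^'n \<Rightarrow> bool"
  where "sym_pos_def M \<longleftrightarrow> transpose M = M \<and> (\<forall>v. v \<noteq> 0 \<longrightarrow> 0 < v \<bullet> (M *v v))"

text \<open>The set of real eigenvalues of a matrix is finite, and it is nonempty if the matrix is
  symmetric, so that \<^const>\<open>Min\<close> and \<^const>\<open>Max\<close> are meaningful below.\<close>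

definition eigenvalues :: "real^'n^'n \<Rightarrow> real set"
  where "eigenvalues M = {l. \<exists>v. v \<noteq> 0 \<and> M *v v = l *\<^sub>R v}"

definition lambda_min :: "real^'n^'n \<Rightarrow> real"
  where "lambda_min M = Min (eigenvalues M)"

definition lambda_max :: "real^'n^'n \<Rightarrow> real"
  where "lambda_max M = Max (eigenvalues M)"

definition sq_norm_wrt :: "real^'n^'n \<Rightarrow> real^'n \<Rightarrow> real"
  where "sq_norm_wrt M v = v \<bullet> (M *v v)"

text \<open>The minimizers below exist and are unique if \<open>\<phi>\<close> is proper, closed and convex, \<open>M\<close> is
  symmetric positive definite and \<open>\<gamma> > 0\<close>.\<close>

definition prox_mat :: "real^'n^'n \<Rightarrow> (real^'n \<Rightarrow> ereal) \<Rightarrow> real^'n \<Rightarrow> real^'n"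
  where "prox_mat M \<phi> x = arg_min (\<lambda>y. \<phi> y + ereal (1 / 2 * sq_norm_wrt M (y - x))) (\<lambda>_. True)"

definition prox :: "real \<Rightarrow> ('a::real_normed_vector \<Rightarrow> ereal) \<Rightarrow> 'a \<Rightarrow> 'a"
  where "prox \<gamma> \<phi> x = arg_min (\<lambda>y. \<phi> y + ereal (1 / (2 * \<gamma>) * (norm (y - x))\<^sup>2)) (\<lambda>_. True)"

definition gradient :: "('a::real_inner \<Rightarrow> real) \<Rightarrow> 'a \<Rightarrow> 'a"
  where "gradient h x = (THE D. GDERIV h x :> D)"

definition prox_grad_step ::
    "real \<Rightarrow> ('a::real_inner \<Rightarrow> ereal) \<Rightarrow> ('a \<Rightarrow> real) \<Rightarrow> 'a \<Rightarrow> 'a"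
  where "prox_grad_step \<gamma> h1 h2 z = prox \<gamma> h1 (z - \<gamma> *\<^sub>R gradient h2 z)"

text \<open>The smooth part of the \<open>z\<close>-subproblem, with \<open>zk\<close>, \<open>x'\<close>, \<open>x\<close> standing for the iterates
  \<open>z\<^sup>k\<close>, \<open>x\<^sup>k\<^sup>+\<^sup>1\<close>, \<open>x\<^sup>k\<close>.\<close>

definition subproblem_smooth ::
    "real^'m^'m \<Rightarrow> real^'n^'m \<Rightarrow> real^'m \<Rightarrow> real^'n \<Rightarrow> real^'n \<Rightarrow> real^'m \<Rightarrow> real"
  where "subproblem_smooth M2 A zk x' x z =
    1 / 2 * sq_norm_wrt M2 (z - zk - matrix_inv M2 *v (A *v (2 *\<^sub>R x' - x)))"

text \<open>The iterator is usually written \<open>S(z\<^sub>i, x\<^sup>k\<^sup>+\<^sup>1, x\<^sup>k)\<close>. As the subproblem it is applied to also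
  depends on \<open>z\<^sup>k\<close>, the iterator here receives \<open>z\<^sup>k\<close> as an explicit first argument.\<close>

definition prox_grad_iterator ::
    "real \<Rightarrow> (real^'m \<Rightarrow> ereal) \<Rightarrow> real^'m^'m \<Rightarrow> real^'n^'m \<Rightarrow>
      real^'m \<Rightarrow> real^'m \<Rightarrow> real^'n \<Rightarrow> real^'n \<Rightarrow> real^'m"
  where "prox_grad_iterator \<gamma> g M2 A zk zi x' x =
    prox_grad_step \<gamma> (conjugate g) (subproblem_smooth M2 A zk x' x) zi"

text \<open>\<open>iPrePDHG f A M1 S p x z w\<close>: the sequences \<open>x k\<close> and \<open>z k\<close> are the outer iterates started
  at \<open>(x 0, z 0)\<close>, and \<open>w (Suc k) i\<close> is the inner iterate \<open>z\<^sup>k\<^sup>+\<^sup>1\<^sub>i\<close>.\<close>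

definition iPrePDHG ::
    "(real^'n \<Rightarrow> ereal) \<Rightarrow> real^'n^'m \<Rightarrow> real^'n^'n \<Rightarrow>
      (real^'m \<Rightarrow> real^'m \<Rightarrow> real^'n \<Rightarrow> real^'n \<Rightarrow> real^'m) \<Rightarrow> nat \<Rightarrow>
      (nat \<Rightarrow> real^'n) \<Rightarrow> (nat \<Rightarrow> real^'m) \<Rightarrow> (nat \<Rightarrow> nat \<Rightarrow> real^'m) \<Rightarrow> bool"
  where "iPrePDHG f A M1 S p x z w \<longleftrightarrow> (\<forall>k.
    x (Suc k) = prox_mat M1 f (x k - matrix_inv M1 *v (transpose A *v z k)) \<and>
    w (Suc k) 0 = z k \<and>
    (\<forall>i<p. w (Suc k) (Suc i) = S (z k) (w (Suc k) i) (x (Suc k)) (x k)) \<and>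
    z (Suc k) = w (Suc k) p)"

end

theory Submission
  imports Defs
begin

text \<open>The map \<open>T\<close> carrying \<open>z\<^sub>i\<close> to \<open>z\<^sub>i\<^sub>+\<^sub>1\<close> is the composition of the gradient step, whose
  linear part \<open>I - \<gamma> M\<^sub>2\<close> has operator norm at most \<open>\<tau>\<close>, with a nonexpansive proximal map, hence a
  \<open>\<tau>\<close>-contraction with a fixed point \<open>z\<^sup>\<star>\<close>. The optimality condition of the last proximal step holds
  with \<open>\<epsilon> = (z\<^sub>p - z\<^sub>p\<^sub>-\<^sub>1) / \<gamma> + M\<^sub>2 (z\<^sub>p\<^sub>-\<^sub>1 - z\<^sub>p)\<close>. Comparing with \<open>z\<^sup>\<star>\<close>,
  \<open>\<parallel>z\<^sub>p - z\<^sub>p\<^sub>-\<^sub>1\<parallel> \<le> (\<tau>\<^sup>p + \<tau>\<^sup>p\<^sup>-\<^sup>1) \<parallel>z\<^sub>0 - z\<^sup>\<star>\<parallel>\<close> and \<open>\<parallel>z\<^sub>p - z\<^sub>0\<parallel> \<ge> (1 - \<tau>\<^sup>p) \<parallel>z\<^sub>0 - z\<^sup>\<star>\<parallel>\<close>.\<close>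

text \<open>Divide by \<open>t\<close> and let \<open>t\<close> tend to 0 from the right. This is
  the first-order step both in the eigenvector argument and in the optimality condition for
  \<open>prox\<close>.\<close>

lemma nonneg_if_linear_perturbation_nonneg:
  fixes D K :: real
  assumes "\<And>t. 0 < t \<Longrightarrow> t \<le> 1 \<Longrightarrow> 0 \<le> t * D + t\<^sup>2 * K"
  shows "0 \<le> D"
proof -
  have "eventually (\<lambda>t. 0 \<le> D + t * K) (at_right 0)"
  proof (rule eventually_at_rightI[where b = 1])
    fix t :: real
    assume t: "t \<in> {0<..<1}"
    then have "0 \<le> t * (D + t * K)"
      using assms[of t] by (simp add: algebra_simps power2_eq_square)
    then show "0 \<le> D + t * K"
      using t by (simp add: zero_le_mult_iff)
  qed simp
  moreover have "((\<lambda>t. D + t * K) \<longlongrightarrow> D + 0 * K) (at_right 0)"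
    by (intro tendsto_intros)
  ultimately show ?thesis
    using tendsto_lowerbound[of "\<lambda>t. D + t * K" "D + 0 * K" "at_right 0" 0] by simp
qed

section \<open>Eigenvalues of symmetric matrices\<close>

lemma inner_symmetric_matrix:
  fixes M :: "real^'n^'n"
  assumes "transpose M = M"
  shows "u \<bullet> (M *v v) = (M *v u) \<bullet> v"
  by (metis assms dot_lmul_matrix transpose_matrix_vector)

text \<open>By symmetry, eigenvectors of distinct eigenvalues are orthogonal, so choosing one per
  eigenvalue gives an injection onto a pairwise orthogonal set, which is finite in finite
  dimension.\<close>

lemma finite_eigenvalues:
  fixes M :: "real^'n^'n"
  assumes sym: "transpose M = M"
  shows "finite (eigenvalues M)"
proof -
  have "\<forall>l\<in>eigenvalues M. \<exists>v. v \<noteq> 0 \<and> M *v v = l *\<^sub>R v"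
    by (simp add: eigenvalues_def)
  then obtain e where e: "\<And>l. l \<in> eigenvalues M \<Longrightarrow> e l \<noteq> 0 \<and> M *v e l = l *\<^sub>R e l"
    by metis
  have orth: "e l \<bullet> e l' = 0" if "l \<in> eigenvalues M" "l' \<in> eigenvalues M" "l \<noteq> l'" for l l'
  proof -
    have "l' * (e l \<bullet> e l') = l * (e l \<bullet> e l')"
      using inner_symmetric_matrix[OF sym, of "e l" "e l'"] e that by simp
    then show ?thesis
      using that by simp
  qed
  have "inj_on e (eigenvalues M)"
    using orth e by (metis inj_onI inner_eq_zero_iff)
  moreover have "finite (e ` eigenvalues M)"
    by (rule pairwise_orthogonal_imp_finite) (auto simp: pairwise_def orthogonal_def intro: orth)
  ultimately show ?thesis
    using finite_imageD by blast
qed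

text \<open>A minimizer of the quadratic form on the unit sphere is an eigenvector.\<close>

lemma ex_eigenvalue_le_quadratic_form:
  fixes M :: "real^'n^'n"
  assumes sym: "transpose M = M"
  shows "\<exists>l\<in>eigenvalues M. \<forall>v. l * (norm v)\<^sup>2 \<le> v \<bullet> (M *v v)"
proof -
  have "compact (sphere (0::real^'n) 1)" "sphere (0::real^'n) 1 \<noteq> {}"
    by simp_all
  moreover have "continuous_on (sphere 0 1) (\<lambda>v. v \<bullet> (M *v v))"
    by (intro continuous_intros linear_continuous_on matrix_vector_mul_bounded_linear)
  ultimately obtain u where u: "norm u = 1"
    and u_min: "\<And>v. norm v = 1 \<Longrightarrow> u \<bullet> (M *v u) \<le> v \<bullet> (M *v v)"
    using continuous_attains_inf[of "sphere 0 1" "\<lambda>v. v \<bullet> (M *v v)"]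
    by (auto simp: dist_norm)
  define l where "l = u \<bullet> (M *v u)"
  \<comment> \<open>\<open>B\<close> is the shifted operator \<open>M - l I\<close>: its form is
    nonnegative everywhere and vanishes at \<open>u\<close>, which will force
    \<open>B u = 0\<close>.\<close>
  define B where "B v = M *v v - l *\<^sub>R v" for v
  have form: "l * (norm v)\<^sup>2 \<le> v \<bullet> (M *v v)" for v
  proof (cases "v = 0")
    case False
    then have "l \<le> (v /\<^sub>R norm v) \<bullet> (M *v (v /\<^sub>R norm v))"
      unfolding l_def by (intro u_min) simp
    also have "\<dots> = (v \<bullet> (M *v v)) / (norm v)\<^sup>2"
      by (simp add: matrix_vector_mult_scaleR power2_eq_square divide_simps)
    finally show ?thesis
      using False by (simp add: field_simps)
  qed simp
  have B_add: "B (v + t *\<^sub>R w) = B v + t *\<^sub>R B w" for v w t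
    by (simp add: B_def algebra_simps matrix_vector_mult_scaleR)
  have B_sym: "v \<bullet> B w = w \<bullet> B v" for v w
    using inner_symmetric_matrix[OF sym, of v w]
    by (simp add: B_def inner_diff_right inner_commute)
  have B_nonneg: "0 \<le> v \<bullet> B v" for v
    using form[of v] by (simp add: B_def inner_diff_right power2_norm_eq_inner)
  have Bu: "u \<bullet> B u = 0"
    using u by (simp add: B_def inner_diff_right l_def flip: power2_norm_eq_inner)
  \<comment> \<open>The nonnegative form is evaluated at \<open>u - t B u\<close>. Its zeroth-order
    term vanishes, so the coefficient of \<open>t\<close> must be nonnegative.\<close>
  have "0 \<le> - 2 * (B u \<bullet> B u)"
  proof (rule nonneg_if_linear_perturbation_nonneg)
    fix t :: real
    have "0 \<le> (u + (- t) *\<^sub>R B u) \<bullet> B (u + (- t) *\<^sub>R B u)"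
      by (rule B_nonneg)
    also have "\<dots> = t * (- 2 * (B u \<bullet> B u)) + t\<^sup>2 * (B u \<bullet> B (B u))"
      unfolding B_add using Bu B_sym[of u "B u"]
      by (simp add: inner_add_left inner_add_right algebra_simps power2_eq_square)
    finally show "0 \<le> t * (- 2 * (B u \<bullet> B u)) + t\<^sup>2 * (B u \<bullet> B (B u))" .
  qed
  then have "B u = 0"
    using inner_gt_zero_iff[of "B u"] by linarith
  then have "l \<in> eigenvalues M"
    using u by (auto simp: eigenvalues_def B_def intro!: exI[of _ u])
  then show ?thesis
    using form by blast
qed

lemma eigenvalues_uminus: "eigenvalues (- M) = uminus ` eigenvalues M"
proof -
  have "l \<in> eigenvalues (- M) \<longleftrightarrow> - l \<in> eigenvalues M" for l
  proof -
    have *: "(- M) *v v = - (M *v v)" for v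
      using matrix_vector_mult_diff_rdistrib[of 0 M v] by simp
    show ?thesis
      unfolding eigenvalues_def mem_Collect_eq * by (metis minus_minus scaleR_minus_left)
  qed
  then show ?thesis
    by (metis (no_types, lifting) image_iff minus_minus subsetI subset_antisym)
qed

lemma lambda_min_le_quadratic_form:
  fixes M :: "real^'n^'n"
  assumes sym: "transpose M = M"
  shows "lambda_min M * (norm v)\<^sup>2 \<le> v \<bullet> (M *v v)"
proof -
  obtain l where "l \<in> eigenvalues M" "l * (norm v)\<^sup>2 \<le> v \<bullet> (M *v v)"
    using ex_eigenvalue_le_quadratic_form[OF sym] by blast
  moreover from this have "lambda_min M \<le> l"
    unfolding lambda_min_def by (simp add: finite_eigenvalues[OF sym])
  ultimately show ?thesis
    by (meson mult_right_mono order_trans zero_le_power2)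
qed

text \<open>Negation exchanges smallest and largest eigenvalues, so this is the lower bound applied
  to \<open>- M\<close>.\<close>

lemma quadratic_form_le_lambda_max:
  fixes M :: "real^'n^'n"
  assumes sym: "transpose M = M"
  shows "v \<bullet> (M *v v) \<le> lambda_max M * (norm v)\<^sup>2"
proof -
  have "transpose (- M) = - M"
    using sym by (simp add: transpose_def vec_eq_iff)
  then obtain l where l: "- l \<in> eigenvalues (- M)" "- l * (norm v)\<^sup>2 \<le> v \<bullet> ((- M) *v v)"
    using ex_eigenvalue_le_quadratic_form[of "- M"] by (metis minus_minus)
  have "(- M) *v v = - (M *v v)"
    using matrix_vector_mult_diff_rdistrib[of 0 M v] by simp
  then have "v \<bullet> (M *v v) \<le> l * (norm v)\<^sup>2"
    using l(2) by simp
  moreover have "l \<le> lambda_max M"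
    using l(1) unfolding lambda_max_def eigenvalues_uminus
    by (auto intro!: Max_ge finite_eigenvalues[OF sym])
  ultimately show ?thesis
    by (meson mult_right_mono order_trans zero_le_power2)
qed

lemma sym_pos_def_lambda_min_pos:
  fixes M :: "real^'n^'n"
  assumes "sym_pos_def M"
  shows "0 < lambda_min M"
proof -
  have sym: "transpose M = M" and pos: "\<And>v. v \<noteq> 0 \<Longrightarrow> 0 < v \<bullet> (M *v v)"
    using assms by (auto simp: sym_pos_def_def)
  have "lambda_min M \<in> eigenvalues M"
    unfolding lambda_min_def
    using finite_eigenvalues[OF sym] ex_eigenvalue_le_quadratic_form[OF sym] by (intro Min_in) auto
  then obtain v where v: "v \<noteq> 0" "M *v v = lambda_min M *\<^sub>R v"
    by (auto simp: eigenvalues_def)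
  then have "0 < lambda_min M * (v \<bullet> v)"
    using pos[of v] by simp
  then show ?thesis
    using v(1) by (metis inner_gt_zero_iff zero_less_mult_pos2)
qed

lemma lambda_min_le_lambda_max:
  fixes M :: "real^'n^'n"
  assumes "transpose M = M"
  shows "lambda_min M \<le> lambda_max M"
  using lambda_min_le_quadratic_form[OF assms, of "axis undefined 1"]
    quadratic_form_le_lambda_max[OF assms, of "axis undefined 1"]
  by simp

lemma norm_sym_pos_def_le:
  fixes M :: "real^'n^'n"
  assumes "sym_pos_def M"
  shows "norm (M *v v) \<le> lambda_max M * norm v"
proof (cases "M *v v = 0")
  case True
  have "0 \<le> lambda_max M"
    using sym_pos_def_lambda_min_pos[OF assms] lambda_min_le_lambda_max[of M] assms
    by (simp add: sym_pos_def_def)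
  then show ?thesis
    using True by simp
next
  case False
  have sym: "transpose M = M" and psd: "\<And>v. 0 \<le> v \<bullet> (M *v v)"
    using assms unfolding sym_pos_def_def by (auto, metis inner_zero_left order_refl less_imp_le)
  \<comment> \<open>Rescaling \<open>M *v v\<close> to the length of \<open>v\<close> gives equality
    in Cauchy-Schwarz and \<open>norm (v + w) \<le> 2 * norm v\<close>, so the factor 4 from
    polarization cancels exactly.\<close>
  define w where "w = (norm v / norm (M *v v)) *\<^sub>R (M *v v)"
  have norm_w: "norm w = norm v"
    using False by (simp add: w_def)
  have wMv: "w \<bullet> (M *v v) = norm v * norm (M *v v)"
    using False by (simp add: w_def power2_eq_square flip: power2_norm_eq_inner)
  text \<open>Polarization, with \<open>w\<close> of the same length as \<open>v\<close>.\<close>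
  have "4 * (w \<bullet> (M *v v)) = (v + w) \<bullet> (M *v (v + w)) - (v - w) \<bullet> (M *v (v - w))"
    using inner_symmetric_matrix[OF sym, of v w]
    by (simp add: algebra_simps inner_add_left inner_add_right inner_diff_left inner_diff_right
        inner_commute)
  also have "\<dots> \<le> lambda_max M * (norm (v + w))\<^sup>2"
    using quadratic_form_le_lambda_max[OF sym, of "v + w"] psd[of "v - w"] by linarith
  also have "\<dots> \<le> lambda_max M * (2 * norm v)\<^sup>2"
  proof (intro mult_left_mono power_mono)
    show "norm (v + w) \<le> 2 * norm v"
      using norm_triangle_ineq[of v w] norm_w by simp
    show "0 \<le> lambda_max M"
      using sym_pos_def_lambda_min_pos[OF assms] lambda_min_le_lambda_max[OF sym] by simp
  qed simp
  finally have "norm v * norm (M *v v) \<le> norm v * (lambda_max M * norm v)"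
    unfolding wMv by (simp add: power2_eq_square algebra_simps)
  moreover have "0 < norm v"
    using False by auto
  ultimately show ?thesis
    by simp
qed

text \<open>In the expanded square, the cross term is controlled by \<open>lambda_min\<close> and
  the quadratic term by \<open>lambda_max\<close>. The resulting factor is the square of the
  contraction constant.\<close>

lemma norm_gradient_step_sq_le:
  fixes M :: "real^'n^'n"
  assumes M: "sym_pos_def M" and \<gamma>: "0 \<le> \<gamma>"
  shows "(norm (v - \<gamma> *\<^sub>R (M *v v)))\<^sup>2
    \<le> (1 - \<gamma> * (2 * lambda_min M - \<gamma> * (lambda_max M)\<^sup>2)) * (norm v)\<^sup>2"
proof -
  have sym: "transpose M = M"
    using M by (simp add: sym_pos_def_def)
  have "(norm (v - \<gamma> *\<^sub>R (M *v v)))\<^sup>2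
    = (norm v)\<^sup>2 - 2 * \<gamma> * (v \<bullet> (M *v v)) + \<gamma>\<^sup>2 * (norm (M *v v))\<^sup>2"
    unfolding power2_norm_eq_inner
    by (simp add: inner_diff_left inner_diff_right inner_commute algebra_simps power2_eq_square)
  also have "\<dots> \<le> (norm v)\<^sup>2 - 2 * \<gamma> * (lambda_min M * (norm v)\<^sup>2)
      + \<gamma>\<^sup>2 * (lambda_max M * norm v)\<^sup>2"
    using \<gamma> by (intro add_mono diff_mono mult_left_mono lambda_min_le_quadratic_form[OF sym]
        power_mono norm_sym_pos_def_le[OF M]) auto
  finally show ?thesis
    by (simp add: algebra_simps power2_eq_square)
qed

section \<open>Proximal maps\<close>

text \<open>The affine minorant makes the prox objective coercive.\<close>

lemma prox_minimizer_exists: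
  fixes \<phi> :: "'a::euclidean_space \<Rightarrow> ereal"
  assumes proper: "proper_fun \<phi>" and closed: "closed_fun \<phi>"
    and minorant: "\<And>y. ereal (y \<bullet> a - b) \<le> \<phi> y" and \<gamma>: "0 < \<gamma>"
  shows "\<exists>q. \<forall>y. \<phi> q + ereal (1 / (2 * \<gamma>) * (norm (q - v))\<^sup>2)
    \<le> \<phi> y + ereal (1 / (2 * \<gamma>) * (norm (y - v))\<^sup>2)"
proof -
  define Q where "Q y = 1 / (2 * \<gamma>) * (norm (y - v))\<^sup>2" for y
  have real_value: "\<exists>r. \<phi> y = ereal r" if "\<phi> y \<noteq> \<infinity>" for y
    using proper that unfolding proper_fun_def by (cases "\<phi> y") auto
  obtain y0 r0 where y0: "\<phi> y0 = ereal r0"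
    using proper real_value unfolding proper_fun_def by blast
  \<comment> \<open>A sublevel set of the objective, lifted to the epigraph: there the objective is
    the continuous function \<open>snd p + Q (fst p)\<close>, and closedness of
    \<open>\<phi>\<close> makes \<open>C\<close> closed.\<close>
  define C where "C = ext_epigraph \<phi> \<inter> {p. snd p + Q (fst p) \<le> r0 + Q y0}"
  have cont: "continuous_on UNIV (\<lambda>p::'a \<times> real. snd p + Q (fst p))"
    unfolding Q_def by (intro continuous_intros)
  have "closed C"
    unfolding C_def using closed cont
    by (auto simp: closed_fun_def intro!: closed_Int closed_Collect_le continuous_intros)
  moreover have "bounded C"
  proof -
    define c where "c = r0 + Q y0 + b - v \<bullet> a"
    \<comment> \<open>Chosen to contradict the quadratic inequality for \<open>n\<close> below: the
      summand 1 forces \<open>1 \<le> n\<close> when \<open>n\<close> exceeds \<open>d\<close>, so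
      the constant term is absorbed into one linear in \<open>n\<close>.\<close>
    define d where "d = 2 * \<gamma> * norm a + 2 * \<gamma> * \<bar>c\<bar> + 1"
    define e where "e = norm v + d"
    have "norm y \<le> e \<and> \<bar>r\<bar> \<le> e * norm a + \<bar>b\<bar> + \<bar>r0 + Q y0\<bar>" if "(y, r) \<in> C" for y r
    proof -
      have le: "r + Q y \<le> r0 + Q y0" and "\<phi> y \<le> ereal r"
        using that by (auto simp: C_def ext_epigraph_def)
      then have r: "y \<bullet> a - b \<le> r"
        using minorant[of y] by (metis ereal_less_eq(3) order_trans)
      define n where "n = norm (y - v)"
      have n0: "0 \<le> n"
        by (simp add: n_def)
      have "(y - v) \<bullet> a + Q y \<le> c"
        using le r by (simp add: c_def inner_diff_left)
      moreover have "- (n * norm a) \<le> (y - v) \<bullet> a"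
        using Cauchy_Schwarz_ineq2[of "y - v" a] by (simp add: n_def abs_le_iff)
      ultimately have "1 / (2 * \<gamma>) * n\<^sup>2 \<le> n * norm a + \<bar>c\<bar>"
        unfolding Q_def n_def by linarith
      then have n2: "n * n \<le> n * (2 * \<gamma> * norm a) + 2 * \<gamma> * \<bar>c\<bar>"
        using \<gamma> by (simp add: field_simps power2_eq_square)
      have n: "n \<le> d"
      proof (rule ccontr)
        assume "\<not> n \<le> d"
        moreover have "0 \<le> 2 * \<gamma> * norm a" and c0: "0 \<le> 2 * \<gamma> * \<bar>c\<bar>"
          using \<gamma> by simp_all
        ultimately have "1 \<le> n" and gt: "2 * \<gamma> * norm a + 2 * \<gamma> * \<bar>c\<bar> < n"
          unfolding d_def by linarith+
        then have "2 * \<gamma> * \<bar>c\<bar> \<le> n * (2 * \<gamma> * \<bar>c\<bar>)"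
          using mult_right_mono[OF \<open>1 \<le> n\<close> c0] by simp
        moreover have "n * (2 * \<gamma> * norm a + 2 * \<gamma> * \<bar>c\<bar>) < n * n"
          using gt \<open>1 \<le> n\<close> by (intro mult_strict_left_mono) auto
        ultimately show False
          using n2 by (simp add: distrib_left)
      qed
      then have y: "norm y \<le> e"
        using norm_triangle_ineq[of "y - v" v] by (simp add: e_def n_def)
      have "\<bar>y \<bullet> a\<bar> \<le> e * norm a"
        using Cauchy_Schwarz_ineq2[of y a] mult_right_mono[OF y norm_ge_zero[of a]] by linarith
      moreover have "0 \<le> Q y"
        using \<gamma> by (simp add: Q_def)
      ultimately show ?thesis
        using y r le by (auto simp: abs_le_iff)
    qed
    then have "C \<subseteq> cball 0 e \<times> cball 0 (e * norm a + \<bar>b\<bar> + \<bar>r0 + Q y0\<bar>)"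
      by auto
    then show ?thesis
      by (rule bounded_subset[rotated]) (intro bounded_Times bounded_cball)
  qed
  ultimately have "compact C"
    by (simp add: compact_eq_bounded_closed)
  moreover have "(y0, r0) \<in> C"
    using y0 by (simp add: C_def ext_epigraph_def)
  ultimately obtain p where p: "p \<in> C"
    and p_min: "\<And>p'. p' \<in> C \<Longrightarrow> snd p + Q (fst p) \<le> snd p' + Q (fst p')"
    using continuous_attains_inf[of C "\<lambda>p. snd p + Q (fst p)"] continuous_on_subset[OF cont]
    by (metis empty_iff subset_UNIV)
  obtain q r where qr: "p = (q, r)"
    by (cases p)
  have "\<phi> q + ereal (Q q) \<le> \<phi> y + ereal (Q y)" for y
  proof (cases "\<phi> y = \<infinity>")
    case False
    then obtain s where s: "\<phi> y = ereal s"
      using real_value by blast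
    have "r + Q q \<le> s + Q y"
    proof (cases "(y, s) \<in> C")
      case True
      then show ?thesis
        using p_min[of "(y, s)"] qr by simp
    next
      \<comment> \<open>Outside \<open>C\<close> the value at \<open>(y, s)\<close> exceeds the
        level \<open>r0 + Q y0\<close>, which already bounds the minimum over
        \<open>C\<close>.\<close>
      case False
      then show ?thesis
        using s p qr by (auto simp: C_def ext_epigraph_def)
    qed
    then have "ereal r + ereal (Q q) \<le> \<phi> y + ereal (Q y)"
      by (simp add: s)
    moreover have "\<phi> q + ereal (Q q) \<le> ereal r + ereal (Q q)"
      using p qr by (intro add_right_mono) (simp add: C_def ext_epigraph_def)
    ultimately show ?thesis
      by (rule order_trans[rotated])
  qed simp
  then show ?thesis
    unfolding Q_def by blast
qed

text \<open>A subgradient at a point of value infinity would force the function to be infinite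
  everywhere, against properness.\<close>

lemma subdifferential_finite:
  assumes "proper_fun \<phi>" and "u \<in> subdifferential \<phi> x"
  obtains r where "\<phi> x = ereal r"
proof -
  obtain y where y: "\<phi> y \<noteq> \<infinity>"
    using assms(1) by (auto simp: proper_fun_def)
  have "\<phi> x + ereal (u \<bullet> (y - x)) \<le> \<phi> y"
    using assms(2) by (simp add: subdifferential_def)
  with y have "\<phi> x \<noteq> \<infinity>"
    by auto
  moreover have "\<phi> x \<noteq> - \<infinity>"
    using assms(1) by (simp add: proper_fun_def)
  ultimately show thesis
    using that by (cases "\<phi> x") auto
qed

text \<open>Add the two subgradient inequalities; the function values are finite and cancel.\<close>

lemma subdifferential_monotone:
  assumes "proper_fun \<phi>" and u: "u \<in> subdifferential \<phi> x" and v: "v \<in> subdifferential \<phi> y"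
  shows "0 \<le> (u - v) \<bullet> (x - y)"
proof -
  obtain r s where r: "\<phi> x = ereal r" and s: "\<phi> y = ereal s"
    using subdifferential_finite assms by metis
  have "\<phi> x + ereal (u \<bullet> (y - x)) \<le> \<phi> y" "\<phi> y + ereal (v \<bullet> (x - y)) \<le> \<phi> x"
    using u v by (simp_all add: subdifferential_def)
  then have "r + u \<bullet> (y - x) \<le> s" "s + v \<bullet> (x - y) \<le> r"
    by (simp_all add: r s)
  then show ?thesis
    by (simp add: inner_diff_left inner_diff_right)
qed

text \<open>The minimizer is compared with points on the segment to \<open>y\<close>: convexity
  bounds \<open>\<phi>\<close> linearly in \<open>t\<close>, the quadratic term expands exactly, and
  the first-order part is the subgradient inequality.\<close>

lemma prox_optimality:
  fixes \<phi> :: "'a::euclidean_space \<Rightarrow> ereal"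
  assumes proper: "proper_fun \<phi>" and closed: "closed_fun \<phi>" and convex: "convex_fun \<phi>"
    and minorant: "\<And>y. ereal (y \<bullet> a - b) \<le> \<phi> y" and \<gamma>: "0 < \<gamma>"
  shows "(1 / \<gamma>) *\<^sub>R (v - prox \<gamma> \<phi> v) \<in> subdifferential \<phi> (prox \<gamma> \<phi> v)"
proof -
  define q where "q = prox \<gamma> \<phi> v"
  define Q where "Q y = 1 / (2 * \<gamma>) * (norm (y - v))\<^sup>2" for y
  \<comment> \<open>\<open>arg_min\<close> is a choice operator, so it yields a minimizer only once
    existence is known.\<close>
  have "\<exists>q. is_arg_min (\<lambda>y. \<phi> y + ereal (Q y)) (\<lambda>_. True) q"
    unfolding is_arg_min_def Q_def
    using prox_minimizer_exists[OF proper closed minorant \<gamma>, of v] by (meson not_le)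
  then have "is_arg_min (\<lambda>y. \<phi> y + ereal (Q y)) (\<lambda>_. True) q"
    unfolding q_def prox_def arg_min_def Q_def by (rule someI_ex)
  then have q_min: "\<phi> q + ereal (Q q) \<le> \<phi> y + ereal (Q y)" for y
    by (auto simp: is_arg_min_def not_less)
  have real_value: "\<exists>r. \<phi> y = ereal r" if "\<phi> y \<noteq> \<infinity>" for y
    using proper that unfolding proper_fun_def by (cases "\<phi> y") auto
  have "\<phi> q \<noteq> \<infinity>"
    using proper q_min unfolding proper_fun_def by fastforce
  then obtain r where r: "\<phi> q = ereal r"
    using real_value by blast
  have "\<phi> q + ereal (((1 / \<gamma>) *\<^sub>R (v - q)) \<bullet> (y - q)) \<le> \<phi> y" for y
  proof (cases "\<phi> y = \<infinity>")
    case False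
    then obtain s where s: "\<phi> y = ereal s"
      using real_value by blast
    have "0 \<le> s - r - 1 / \<gamma> * ((v - q) \<bullet> (y - q))"
    proof (rule nonneg_if_linear_perturbation_nonneg)
      fix t :: real
      assume t: "0 < t" "t \<le> 1"
      define yt where "yt = (1 - t) *\<^sub>R q + t *\<^sub>R y"
      have "(1 - t) *\<^sub>R (q, r) + t *\<^sub>R (y, s) \<in> ext_epigraph \<phi>"
        using convex t r s unfolding convex_fun_def
        by (intro convexD) (auto simp: ext_epigraph_def)
      then have "\<phi> yt \<le> ereal ((1 - t) * r + t * s)"
        by (simp add: ext_epigraph_def yt_def)
      then have "\<phi> yt + ereal (Q yt) \<le> ereal ((1 - t) * r + t * s) + ereal (Q yt)"
        by (rule add_right_mono)
      then have "r + Q q \<le> (1 - t) * r + t * s + Q yt"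
        using order_trans[OF q_min[of yt]] by (fastforce simp: r)
      moreover have "Q yt = Q q - t * (1 / \<gamma> * ((v - q) \<bullet> (y - q)))
          + t\<^sup>2 * (1 / (2 * \<gamma>) * (norm (y - q))\<^sup>2)"
      proof -
        have yt: "yt - v = (q - v) + t *\<^sub>R (y - q)"
          by (simp add: yt_def algebra_simps)
        have "(norm (yt - v))\<^sup>2
          = (norm (q - v))\<^sup>2 - 2 * t * ((v - q) \<bullet> (y - q)) + t\<^sup>2 * (norm (y - q))\<^sup>2"
          unfolding power2_norm_eq_inner yt
          by (simp add: inner_add_left inner_add_right inner_diff_left inner_diff_right
              inner_commute algebra_simps power2_eq_square)
        then show ?thesis
          using \<gamma> by (simp add: Q_def field_simps)
      qed
      ultimately show "0 \<le> t * (s - r - 1 / \<gamma> * ((v - q) \<bullet> (y - q)))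
          + t\<^sup>2 * (1 / (2 * \<gamma>) * (norm (y - q))\<^sup>2)"
        by (simp add: algebra_simps)
    qed
    then show ?thesis
      by (simp add: r s)
  qed simp
  then show ?thesis
    by (simp add: subdifferential_def q_def)
qed

text \<open>Monotonicity at the two optimality conditions gives firm nonexpansiveness,
  \<open>d \<bullet> d \<le> (u - v) \<bullet> d\<close>; Cauchy-Schwarz does the rest.\<close>

lemma norm_diff_prox_le:
  fixes \<phi> :: "'a::euclidean_space \<Rightarrow> ereal"
  assumes proper: "proper_fun \<phi>" and closed: "closed_fun \<phi>" and convex: "convex_fun \<phi>"
    and minorant: "\<And>y. ereal (y \<bullet> a - b) \<le> \<phi> y" and \<gamma>: "0 < \<gamma>"
  shows "norm (prox \<gamma> \<phi> u - prox \<gamma> \<phi> v) \<le> norm (u - v)"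
proof -
  define d where "d = prox \<gamma> \<phi> u - prox \<gamma> \<phi> v"
  note opt = prox_optimality[OF proper closed convex minorant \<gamma>]
  have "0 \<le> ((1 / \<gamma>) *\<^sub>R (u - prox \<gamma> \<phi> u) - (1 / \<gamma>) *\<^sub>R (v - prox \<gamma> \<phi> v)) \<bullet> d"
    unfolding d_def by (rule subdifferential_monotone[OF proper opt opt])
  also have "\<dots> = 1 / \<gamma> * ((u - v) \<bullet> d - d \<bullet> d)"
    by (simp add: d_def inner_diff_left algebra_simps flip: scaleR_diff_right)
  finally have "d \<bullet> d \<le> (u - v) \<bullet> d"
    using \<gamma> by (simp add: zero_le_divide_iff)
  then have "norm d * norm d \<le> norm (u - v) * norm d"
    using norm_cauchy_schwarz[of "u - v" d] by (simp add: power2_eq_square flip: power2_norm_eq_inner)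
  then show ?thesis
    unfolding d_def by (metis mult_right_le_imp_le norm_ge_zero order_le_less)
qed

section \<open>Conjugates\<close>

text \<open>The epigraph of a supremum is an intersection, so closedness and convexity reduce to the
  single terms.\<close>

lemma ext_epigraph_conjugate:
  "ext_epigraph (conjugate \<phi>) = (\<Inter>x. {(z, r). ereal (z \<bullet> x) - \<phi> x \<le> ereal r})"
  by (auto simp: ext_epigraph_def conjugate_def SUP_le_iff)

text \<open>A real \<open>c\<close> gives a half-space with normal \<open>(x, -1)\<close>; the
  infinite values give the whole space or the empty set.\<close>

lemma closed_convex_affine_epigraph:
  fixes c :: ereal and x :: "'a::real_inner"
  shows "closed {(z, r). ereal (z \<bullet> x) - c \<le> ereal r}"
    and "convex {(z, r). ereal (z \<bullet> x) - c \<le> ereal r}"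
proof -
  have "closed {(z, r). ereal (z \<bullet> x) - c \<le> ereal r} \<and>
    convex {(z, r). ereal (z \<bullet> x) - c \<le> ereal r}"
  proof (cases c)
    case (real s)
    have "{(z, r). ereal (z \<bullet> x) - c \<le> ereal r} = {p. (x, - 1) \<bullet> p \<le> s}"
      by (auto simp: real inner_commute algebra_simps)
    then show ?thesis
      by (simp only: closed_halfspace_le convex_halfspace_le)
  qed auto
  then show "closed {(z, r). ereal (z \<bullet> x) - c \<le> ereal r}"
    and "convex {(z, r). ereal (z \<bullet> x) - c \<le> ereal r}"
    by simp_all
qed

lemma closed_conjugate: "closed_fun (conjugate \<phi>)"
  unfolding closed_fun_def ext_epigraph_conjugate
  by (intro closed_INT ballI closed_convex_affine_epigraph)

lemma convex_conjugate: "convex_fun (conjugate \<phi>)"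
  unfolding convex_fun_def ext_epigraph_conjugate
  by (intro convex_INT closed_convex_affine_epigraph)

text \<open>The Fenchel-Young inequality, which supplies the affine minorant required by the results
  on \<open>prox\<close>.\<close>

lemma conjugate_minorant:
  assumes "\<phi> a = ereal b"
  shows "ereal (z \<bullet> a - b) \<le> conjugate \<phi> z"
  unfolding conjugate_def using assms by (intro SUP_upper2[of a]) auto

text \<open>The subgradient \<open>u\<close> is itself a point of finite conjugate value: the
  subgradient inequality bounds every term of the supremum by
  \<open>u \<bullet> x - r\<close>.\<close>

lemma proper_conjugate:
  assumes proper: "proper_fun \<phi>" and u: "u \<in> subdifferential \<phi> x"
  shows "proper_fun (conjugate \<phi>)"
proof -
  obtain r where r: "\<phi> x = ereal r"
    using subdifferential_finite[OF proper u] .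
  have "conjugate \<phi> u \<le> ereal (u \<bullet> x - r)"
    unfolding conjugate_def
  proof (rule SUP_least)
    fix y
    have "\<phi> x + ereal (u \<bullet> (y - x)) \<le> \<phi> y"
      using u by (simp add: subdifferential_def)
    then show "ereal (u \<bullet> y) - \<phi> y \<le> ereal (u \<bullet> x - r)"
      by (cases "\<phi> y") (auto simp: r inner_diff_right)
  qed
  moreover have "conjugate \<phi> z \<noteq> - \<infinity>" for z
    using conjugate_minorant[where \<phi> = \<phi> and a = x, OF r, of z] by auto
  ultimately show ?thesis
    unfolding proper_fun_def by (auto intro!: exI[of _ u])
qed

section \<open>The proximal-gradient inner loop\<close>

text \<open>Symmetry merges the two product-rule terms and cancels the factor 1/2. Since
  \<open>gradient\<close> is a definite description, uniqueness of the derivative is needed as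
  well.\<close>

lemma gradient_subproblem_smooth:
  assumes sym: "transpose M = M"
  shows "gradient (subproblem_smooth M A zk x' x) z
    = M *v (z - zk - matrix_inv M *v (A *v (2 *\<^sub>R x' - x)))"
proof -
  define b where "b = zk + matrix_inv M *v (A *v (2 *\<^sub>R x' - x))"
  have smooth: "subproblem_smooth M A zk x' x = (\<lambda>z. 1 / 2 * ((z - b) \<bullet> (M *v (z - b))))"
    by (simp add: fun_eq_iff subproblem_smooth_def sq_norm_wrt_def b_def diff_diff_eq)
  have "((\<lambda>z. 1 / 2 * ((z - b) \<bullet> (M *v (z - b)))) has_derivative
      (\<lambda>h. 1 / 2 * ((z - b) \<bullet> (M *v h) + h \<bullet> (M *v (z - b))))) (at z)"
    by (auto intro!: derivative_eq_intros
        bounded_linear.has_derivative[OF matrix_vector_mul_bounded_linear])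
  moreover have "(\<lambda>h. 1 / 2 * ((z - b) \<bullet> (M *v h) + h \<bullet> (M *v (z - b))))
      = (\<lambda>h. h \<bullet> (M *v (z - b)))"
    using inner_symmetric_matrix[OF sym, of "z - b"] by (simp add: fun_eq_iff inner_commute)
  ultimately have deriv: "GDERIV (subproblem_smooth M A zk x' x) z :> M *v (z - b)"
    by (simp add: gderiv_def smooth inner_commute)
  have "gradient (subproblem_smooth M A zk x' x) z = M *v (z - b)"
    unfolding gradient_def using deriv
  proof (rule the_equality)
    fix D
    assume "GDERIV (subproblem_smooth M A zk x' x) z :> D"
    then have "(\<lambda>h. h \<bullet> D) = (\<lambda>h. h \<bullet> (M *v (z - b)))"
      using deriv has_derivative_unique unfolding gderiv_def by blast
    then show "D = M *v (z - b)"
      by (metis inner_commute vector_eq_ldot)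
  qed
  then show ?thesis
    by (simp add: b_def diff_diff_eq)
qed

lemma contraction_increment_le:
  fixes T :: "'a::{real_normed_vector,complete_space} \<Rightarrow> 'a"
  assumes \<tau>: "0 \<le> \<tau>" "\<tau> < 1" and T: "\<And>u v. norm (T u - T v) \<le> \<tau> * norm (u - v)"
    and w: "\<And>i. i < p \<Longrightarrow> w (Suc i) = T (w i)" and p: "1 \<le> p"
  shows "norm (w p - w (p - 1)) \<le> (\<tau> ^ p + \<tau> ^ (p - 1)) / (1 - \<tau> ^ p) * norm (w p - w 0)"
proof -
  have "\<exists>!s. s \<in> UNIV \<and> T s = s"
    using \<tau> T by (intro Banach_fix[of _ \<tau>]) (auto simp: complete_UNIV dist_norm)
  then obtain s where s: "T s = s"
    by blast
  define D where "D = norm (w 0 - s)"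
  have dist: "norm (w i - s) \<le> \<tau> ^ i * D" if "i \<le> p" for i
    using that
  proof (induction i)
    case (Suc i)
    have "norm (w (Suc i) - s) \<le> \<tau> * norm (w i - s)"
      using T[of "w i" s] w[of i] Suc.prems s by simp
    also have "\<dots> \<le> \<tau> * (\<tau> ^ i * D)"
      using Suc \<tau> by (intro mult_left_mono) auto
    finally show ?case
      by simp
  qed (simp add: D_def)
  \<comment> \<open>Strict because \<open>1 \<le> p\<close>; this makes the later division by
    \<open>1 - \<tau> ^ p\<close> legitimate.\<close>
  have pow: "\<tau> ^ p < 1"
    using \<tau> p by (simp add: power_less_one_iff)
  have "norm (w p - w (p - 1)) \<le> norm (w p - s) + norm (w (p - 1) - s)"
    using norm_triangle_ineq4[of "w p - s" "w (p - 1) - s"] by simp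
  \<comment> \<open>For \<open>p = 1\<close> the second power is \<open>\<tau> ^ 0 = 1\<close>, even
    when \<tau> is 0, in line with the stated convention.\<close>
  also have "\<dots> \<le> (\<tau> ^ p + \<tau> ^ (p - 1)) * D"
    using dist[of p] dist[of "p - 1"] by (simp add: distrib_right)
  also have "D \<le> norm (w p - w 0) / (1 - \<tau> ^ p)"
  proof -
    have "D \<le> norm (w p - s) + norm (w p - w 0)"
      unfolding D_def using norm_triangle_ineq4[of "w p - s" "w p - w 0"] by simp
    then have "(1 - \<tau> ^ p) * D \<le> norm (w p - w 0)"
      using dist[of p] by (simp add: left_diff_distrib)
    then show ?thesis
      using pow by (simp add: pos_le_divide_eq mult.commute)
  qed
  finally show ?thesis
    using \<tau> by (simp add: mult_left_mono)
qed

theorem theorem3p4: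
  fixes f :: "real^'n \<Rightarrow> ereal" and g :: "real^'m \<Rightarrow> ereal"
    and A :: "real^'n^'m" and M1 :: "real^'n^'n" and M2 :: "real^'m^'m"
    and \<gamma> \<tau> c :: real and p :: nat
    and x :: "nat \<Rightarrow> real^'n" and z :: "nat \<Rightarrow> real^'m" and w :: "nat \<Rightarrow> nat \<Rightarrow> real^'m"
  assumes "proper_fun f" and "closed_fun f" and "convex_fun f"
    and "proper_fun g" and "closed_fun g" and "convex_fun g"
    and "\<exists>xs zs. primal_dual_solution f g A xs zs"
    and "sym_pos_def M1" and "sym_pos_def M2"
    and "0 < \<gamma>" and "\<gamma> < 2 * lambda_min M2 / (lambda_max M2)\<^sup>2"
    and "1 \<le> p"
    and "iPrePDHG f A M1 (prox_grad_iterator \<gamma> g M2 A) p x z w"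
    and "\<tau> = sqrt (1 - \<gamma> * (2 * lambda_min M2 - \<gamma> * (lambda_max M2)\<^sup>2))"
    and "c = (1 / \<gamma> + lambda_max M2) / (1 - \<tau> ^ p) * (\<tau> ^ p + \<tau> ^ (p - 1))"
  shows "\<tau> < 1 \<and>
    (\<forall>k. \<exists>\<epsilon> :: real^'m.
      0 \<in> (\<lambda>v. v + M2 *v (z (Suc k) - z k
                   - matrix_inv M2 *v (A *v (2 *\<^sub>R x (Suc k) - x k))) + \<epsilon>)
            ` subdifferential (conjugate g) (z (Suc k)) \<and>
      norm \<epsilon> \<le> c * norm (z (Suc k) - z k))"
proof -
  have M2: "sym_pos_def M2" and sym: "transpose M2 = M2"
    using assms(9) by (simp_all add: sym_pos_def_def)
  have \<gamma>: "0 < \<gamma>"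
    by fact
  define lm lM where "lm = lambda_min M2" and "lM = lambda_max M2"
  have lm: "0 < lm" and lm_le: "lm \<le> lM"
    unfolding lm_def lM_def
    using sym_pos_def_lambda_min_pos[OF M2] lambda_min_le_lambda_max[OF sym] by simp_all
  define rho where "rho = 1 - \<gamma> * (2 * lm - \<gamma> * lM\<^sup>2)"
  have \<tau>_rho: "\<tau> = sqrt rho"
    using assms(14) by (simp add: rho_def lm_def lM_def)
  have "\<gamma> * lM\<^sup>2 < 2 * lm"
    using assms(11) lm lm_le by (simp add: pos_less_divide_eq flip: lm_def lM_def)
  then have "rho < 1"
    using \<gamma> by (simp add: rho_def)
  \<comment> \<open>Completing the square exhibits \<open>rho\<close> as a sum of nonnegative terms.
    This matters because \<open>sqrt\<close> takes negative values at negative arguments.\<close>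
  have "0 \<le> rho"
  proof -
    have "0 \<le> (1 - \<gamma> * lm)\<^sup>2 + \<gamma>\<^sup>2 * (lM\<^sup>2 - lm\<^sup>2)"
      using lm lm_le by simp
    also have "\<dots> = rho"
      by (simp add: rho_def algebra_simps power2_eq_square)
    finally show ?thesis .
  qed
  have \<tau>: "0 \<le> \<tau>" "\<tau> < 1"
    using \<open>rho < 1\<close> \<open>0 \<le> rho\<close> by (simp_all add: \<tau>_rho)

  define h where "h = conjugate g"
  obtain xs zs where "primal_dual_solution f g A xs zs"
    using assms(7) by blast
  \<comment> \<open>The solution pair enters here: \<open>zs\<close> is a point where the conjugate
    of \<open>g\<close> is finite, and \<open>A *v xs\<close> is the slope of its affine
    minorant.\<close>
  then have zs: "zs \<in> subdifferential g (A *v xs)"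
    by (auto simp: primal_dual_solution_def)
  obtain b where b: "g (A *v xs) = ereal b"
    using subdifferential_finite[OF assms(4) zs] .
  have proper: "proper_fun h"
    unfolding h_def by (rule proper_conjugate[OF assms(4) zs])
  have closed: "closed_fun h" and convex: "convex_fun h"
    unfolding h_def by (rule closed_conjugate convex_conjugate)+
  have minorant: "ereal (y \<bullet> (A *v xs) - b) \<le> h y" for y
    unfolding h_def by (rule conjugate_minorant[where \<phi> = g and a = "A *v xs", OF b])

  have "\<exists>\<epsilon>. 0 \<in> (\<lambda>v. v + M2 *v (z (Suc k) - z k
        - matrix_inv M2 *v (A *v (2 *\<^sub>R x (Suc k) - x k))) + \<epsilon>) ` subdifferential h (z (Suc k)) \<and>
      norm \<epsilon> \<le> c * norm (z (Suc k) - z k)" for k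
  proof -
    \<comment> \<open>\<open>s\<close> is the center of the quadratic in the subproblem,
      \<open>G\<close> the gradient step, and \<open>T\<close> one full inner step.\<close>
    define s where "s = z k + matrix_inv M2 *v (A *v (2 *\<^sub>R x (Suc k) - x k))"
    define G where "G u = u - \<gamma> *\<^sub>R (M2 *v (u - s))" for u
    define T where "T u = prox \<gamma> h (G u)" for u
    define y where "y = w (Suc k) (p - 1)"
    have w0: "w (Suc k) 0 = z k" and wp: "w (Suc k) p = z (Suc k)"
      using assms(13) by (auto simp: iPrePDHG_def)
    have w: "w (Suc k) (Suc i) = T (w (Suc k) i)" if "i < p" for i
      using assms(13) that
      by (simp add: iPrePDHG_def prox_grad_iterator_def prox_grad_step_def
          gradient_subproblem_smooth[OF sym] T_def G_def h_def s_def diff_diff_eq)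
    have contraction: "norm (T u - T v) \<le> \<tau> * norm (u - v)" for u v
    proof -
      have "norm (T u - T v) \<le> norm (G u - G v)"
        unfolding T_def by (rule norm_diff_prox_le[OF proper closed convex minorant \<gamma>])
      also have "G u - G v = (u - v) - \<gamma> *\<^sub>R (M2 *v (u - v))"
        by (simp add: G_def algebra_simps)
      also have "norm \<dots> \<le> sqrt (rho * (norm (u - v))\<^sup>2)"
        using norm_gradient_step_sq_le[OF M2, of \<gamma> "u - v"] \<gamma>
        by (intro real_le_rsqrt) (simp add: rho_def lm_def lM_def)
      finally show ?thesis
        by (simp add: \<tau>_rho real_sqrt_mult)
    qed
    have zy: "z (Suc k) = T y"
      using w[of "p - 1"] assms(12) wp by (simp add: y_def)
    \<comment> \<open>The last proximal step uses the gradient at \<open>y\<close>, whereas the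
      inclusion needs it at the new iterate. \<epsilon> collects this gradient difference and the
      proximal residual.\<close>
    define \<epsilon> where "\<epsilon> = (1 / \<gamma>) *\<^sub>R (z (Suc k) - y) + M2 *v (y - z (Suc k))"
    have "(1 / \<gamma>) *\<^sub>R (G y - z (Suc k)) \<in> subdifferential h (z (Suc k))"
      unfolding zy T_def by (rule prox_optimality[OF proper closed convex minorant \<gamma>])
    moreover have "0 = (1 / \<gamma>) *\<^sub>R (G y - z (Suc k)) + M2 *v (z (Suc k) - s) + \<epsilon>"
      using \<gamma> by (simp add: G_def \<epsilon>_def algebra_simps)
    ultimately have "0 \<in> (\<lambda>v. v + M2 *v (z (Suc k) - s) + \<epsilon>) ` subdifferential h (z (Suc k))"
      by (rule rev_image_eqI)
    moreover have "norm \<epsilon> \<le> c * norm (z (Suc k) - z k)"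
    proof -
      have "norm \<epsilon> \<le> 1 / \<gamma> * norm (z (Suc k) - y) + lM * norm (y - z (Suc k))"
        unfolding \<epsilon>_def lM_def using \<gamma>
        by (intro norm_triangle_le add_mono norm_sym_pos_def_le[OF M2]) simp
      also have "\<dots> = (1 / \<gamma> + lM) * norm (z (Suc k) - y)"
        by (simp add: norm_minus_commute distrib_right)
      also have "\<dots> \<le> (1 / \<gamma> + lM)
          * ((\<tau> ^ p + \<tau> ^ (p - 1)) / (1 - \<tau> ^ p) * norm (z (Suc k) - z k))"
        using contraction_increment_le[where w = "w (Suc k)", OF \<tau> contraction w assms(12)]
          \<gamma> lm lm_le
        by (intro mult_left_mono) (auto simp: y_def wp w0)
      finally show ?thesis
        by (simp add: assms(15) lM_def)
    qed
    ultimately show ?thesis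
      by (auto simp: s_def diff_diff_eq)
  qed
  then show ?thesis
    using \<tau>(2) by (simp add: h_def)
qed

end
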